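(* Let $k$ be a positive integer. Then every $k$-connected $(K_2 \cup kK_1)$-free graph $G$ of order $n$ with $2k+1 \leq \alpha(G) < \frac{n}{2}$ and $\delta(G) \geq 2k$ is Hamilton-connected.
   Context: Graphs are finite and simple. $\delta(G)$ is the minimum degree and $\alpha(G)$ the independence number of $G$; the order is the number of vertices. $K_2\cup kK_1$ denotes the disjoint union of one edge $K_2$ and $k$ isolated vertices; a graph is $(K_2\cup kK_1)$-free if it contains no induced subgraph isomorphic to $K_2\cup kK_1$. A graph is $k$-connected if the removal of any set of fewer than $k$ vertices does not disconnect it. A graph is Hamilton-connected if any two distinct vertices are the endpoints of a Hamilton path (a path containing every vertex). *)

theory Defs
  imports "Graph_Theory.Graph_Theory"
begin

text \<open>
  A finite simple graph is a value of type \<^typ>\<open>'a pair_pre_digraph\<close> satisfying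
  \<^locale>\<open>pair_graph\<close>: a finite vertex set with a symmetric, irreflexive adjacency relation
  on it. An edge is thus a pair of opposite arcs, and the degree of a vertex is its out-degree.
\<close>

definition min_degree :: "'a pair_pre_digraph \<Rightarrow> nat" where
  "min_degree G = Min (out_degree (with_proj G) ` pverts G)"

definition independent_set :: "'a pair_pre_digraph \<Rightarrow> 'a set \<Rightarrow> bool" where
  "independent_set G S \<longleftrightarrow> S \<subseteq> pverts G \<and> (\<forall>u\<in>S. \<forall>v\<in>S. (u, v) \<notin> parcs G)"

definition independence_number :: "'a pair_pre_digraph \<Rightarrow> nat" where
  "independence_number G = Max (card ` {S. independent_set G S})"

text \<open>
  Only proper subsets are removed, because the library's \<^const>\<open>connected\<close> is false for the
  graph without vertices. There is no lower bound on the order here; complete graphs are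
  \<open>k\<close>-connected for every \<open>k\<close>.
\<close>

definition k_connected :: "nat \<Rightarrow> 'a pair_pre_digraph \<Rightarrow> bool" where
  "k_connected k G \<longleftrightarrow>
     (\<forall>S. S \<subset> pverts G \<and> card S < k \<longrightarrow> connected (with_proj G \<restriction> (pverts G - S)))"

definition K2_union_kK1 :: "nat \<Rightarrow> nat pair_pre_digraph" where
  "K2_union_kK1 k = \<lparr> pverts = {..<k + 2}, parcs = {(0, 1), (1, 0)} \<rparr>"

definition induced_free :: "'b pair_pre_digraph \<Rightarrow> 'a pair_pre_digraph \<Rightarrow> bool" where
  "induced_free F G \<longleftrightarrow>
     \<not> (\<exists>H. induced_subgraph H (with_proj G) \<and> digraph_iso (with_proj F) H)"

definition hamilton_path :: "'a pair_pre_digraph \<Rightarrow> 'a \<Rightarrow> 'a list \<Rightarrow> 'a \<Rightarrow> bool" where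
  "hamilton_path G u p v \<longleftrightarrow>
     vpath p (with_proj G) \<and> hd p = u \<and> last p = v \<and> set p = pverts G"

definition hamilton_connected :: "'a pair_pre_digraph \<Rightarrow> bool" where
  "hamilton_connected G \<longleftrightarrow>
     (\<forall>u\<in>pverts G. \<forall>v\<in>pverts G. u \<noteq> v \<longrightarrow> (\<exists>p. hamilton_path G u p v))"

end

theory Submission
  imports Defs
begin

text \<open>
  Let \<open>P\<close> be a longest path from \<open>x\<close> to \<open>y\<close>, suppose that it misses a vertex, and let \<open>H\<close> be a component
  of \<open>G - P\<close>. As in the proof of the Chvatal-Erdos theorem, the successors on \<open>P\<close> of the neighbours of
  \<open>H\<close> are independent and not adjacent to \<open>H\<close>, because otherwise a detour through \<open>H\<close> lengthens \<open>P\<close>.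
  The forbidden subgraph says that the vertices nonadjacent to both ends of an edge contain no \<open>k\<close>
  independent ones; hence a vertex with a neighbour in an independent set misses fewer than \<open>k\<close>
  members of it.

  If \<open>H\<close> is a single vertex \<open>h\<close> (\<open>component_not_singleton\<close>), the degree bound gives at least
  \<open>2 * k - 1\<close> successors. Extend them and \<open>h\<close> to a maximal independent set \<open>J\<close>. Every vertex outside
  \<open>J\<close> misses at most \<open>k - 1\<close> members of \<open>J\<close>, so two consecutive vertices of \<open>P\<close> outside \<open>J\<close> would have
  two successors as common neighbours, and the three crossing lemmas turn these into a longer path; a
  vertex off \<open>P\<close> and outside \<open>J\<close> is excluded in the same way. So \<open>J\<close> meets every edge of \<open>P\<close> and
  contains \<open>V - P\<close>, which makes it at least half of \<open>V\<close>, against \<open>\<alpha> < n/2\<close>.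

  If \<open>H\<close> contains an edge (\<open>independent_sets_small\<close>), there are at most \<open>k - 1\<close> successors, and
  \<open>k\<close>-connectedness forces exactly \<open>k\<close> neighbours of \<open>H\<close> on \<open>P\<close>, among them \<open>y\<close>. Together with the
  \<open>k - 1\<close> successors this makes every edge of \<open>H\<close> dominate \<open>H\<close>, that is, \<open>H\<close> is complete
  multipartite. As its vertices have degree at least \<open>k\<close> in \<open>H\<close>, any two of them are joined by a path
  in \<open>H\<close> with at least \<open>k\<close> vertices. An independent set with more than \<open>2 * k\<close> vertices has two of
  them in \<open>H\<close>, so two vertices of \<open>H\<close> are nonadjacent. These two show that every vertex on the last
  segment of \<open>P\<close>, between the last two neighbours of \<open>H\<close>, except the first one, is adjacent to at least
  two successors. Along that segment the positions of these successors have to decrease, again by a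
  crossing argument, so the segment has at most \<open>k - 1\<close> vertices. Replacing it by a path through
  \<open>H\<close> with at least \<open>k\<close> vertices gives a longer path.
\<close>

section \<open>Lists and natural numbers\<close>

lemma split_at_slot:
  assumes "Suc i < length xs"
  obtains A B where "xs = A @ B" "A \<noteq> []" "B \<noteq> []" "last A = xs ! i" "hd B = xs ! Suc i"
    "length A = Suc i"
proof
  show "xs = take (Suc i) xs @ drop (Suc i) xs" by simp
  show "take (Suc i) xs \<noteq> []" "drop (Suc i) xs \<noteq> []" using assms by auto
  show "last (take (Suc i) xs) = xs ! i" using assms by (simp add: take_Suc_conv_app_nth)
  show "hd (drop (Suc i) xs) = xs ! Suc i" using assms by (simp add: hd_drop_conv_nth)
  show "length (take (Suc i) xs) = Suc i" using assms by simp
qed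

lemma split_at_two_slots:
  assumes "i < j" "Suc j < length xs"
  obtains A B C where "xs = A @ B @ C" "A \<noteq> []" "B \<noteq> []" "C \<noteq> []"
    "last A = xs ! i" "hd B = xs ! Suc i" "last B = xs ! j" "hd C = xs ! Suc j"
    "length A = Suc i" "length B = j - i"
proof -
  obtain A R where R: "xs = A @ R" "A \<noteq> []" "R \<noteq> []" "last A = xs ! i" "hd R = xs ! Suc i"
    "length A = Suc i"
    using split_at_slot[of i xs] assms by auto
  have "Suc (j - Suc i) < length R" using R assms by auto
  then obtain B C where B: "R = B @ C" "B \<noteq> []" "C \<noteq> []" "last B = R ! (j - Suc i)"
    "hd C = R ! Suc (j - Suc i)" "length B = Suc (j - Suc i)"
    using split_at_slot[of "j - Suc i" R] by blast
  show thesis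
  proof (rule that[of A B C])
    show "last B = xs ! j" using R(1,6) B(4) assms by (simp add: nth_append)
    show "hd C = xs ! Suc j"
      using R(1,6) B(5) assms by (simp add: nth_append Suc_diff_Suc)
    show "hd B = xs ! Suc i" using R(5) B(1,2) by simp
    show "length B = j - i" using B(6) assms by simp
  qed (use R B in auto)
qed

lemma split_at_three_slots:
  assumes "i < j" "j < l" "Suc l < length xs"
  obtains A B C D where "xs = A @ B @ C @ D" "A \<noteq> []" "B \<noteq> []" "C \<noteq> []" "D \<noteq> []"
    "last A = xs ! i" "hd B = xs ! Suc i" "last B = xs ! j" "hd C = xs ! Suc j"
    "last C = xs ! l" "hd D = xs ! Suc l"
proof -
  obtain A B R where R: "xs = A @ B @ R" "A \<noteq> []" "B \<noteq> []" "R \<noteq> []"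
    "last A = xs ! i" "hd B = xs ! Suc i" "last B = xs ! j" "hd R = xs ! Suc j"
    "length A = Suc i" "length B = j - i"
    by (rule split_at_two_slots[OF assms(1) less_trans[OF _ assms(3)]]) (use assms(2) in simp_all)
  have "Suc (l - Suc j) < length R" using R assms by auto
  then obtain C D where C: "R = C @ D" "C \<noteq> []" "D \<noteq> []" "last C = R ! (l - Suc j)"
    "hd D = R ! Suc (l - Suc j)"
    using split_at_slot[of "l - Suc j" R] by blast
  show thesis
  proof (rule that[of A B C D])
    have len: "length (A @ B) = Suc j" and xs: "xs = (A @ B) @ R" using R assms by auto
    have nth: "xs ! m = R ! (m - Suc j)" if "m \<ge> Suc j" for m
      unfolding xs nth_append len using that by simp
    show "last C = xs ! l" using C(4) nth assms by simp
    show "hd D = xs ! Suc l" using C(5) nth[of "Suc l"] assms by (simp add: Suc_diff_Suc)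
    show "hd C = xs ! Suc j" using R(8) C(1,2) by simp
  qed (use R C in auto)
qed

lemma few_failures_if_no_two_consecutive:
  assumes "successively (\<lambda>a b. Q a \<or> Q b) xs"
  shows "length (filter (\<lambda>a. \<not> Q a) xs) \<le> Suc (length (filter Q xs))"
  using assms
proof (induction xs rule: induct_list012)
  case (3 a b zs)
  have "successively (\<lambda>a b. Q a \<or> Q b) zs" using 3(3) by (cases zs) auto
  then show ?case using 3 by (cases "Q a") auto
qed auto

lemma two_of_card_ge_2:
  fixes S :: "nat set"
  assumes "2 \<le> card S"
  obtains i j where "i \<in> S" "j \<in> S" "i < j"
proof -
  obtain T where "T \<subseteq> S" "card T = 2"
    using obtain_subset_with_card_n[OF assms] by blast
  then obtain i j where "i \<in> S" "j \<in> S" "i \<noteq> j" by (auto simp: card_2_iff)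
  then show thesis using that[of i j] that[of j i] by linarith
qed

section \<open>Graphs as adjacency predicates\<close>

locale simple_graph =
  fixes V :: "'a set" and adj :: "'a \<Rightarrow> 'a \<Rightarrow> bool"
  assumes finite_V: "finite V"
    and adj_sym: "adj u v \<Longrightarrow> adj v u"
    and adj_irrefl: "\<not> adj v v"
    and adj_V: "adj u v \<Longrightarrow> u \<in> V"
begin

lemma adj_commute: "adj u v \<longleftrightarrow> adj v u"
  using adj_sym by blast

lemma adj_V2: "adj u v \<Longrightarrow> v \<in> V"
  using adj_V adj_sym by blast

lemma successively_adj_rev [simp]: "successively (\<lambda>u v. adj v u) p = successively adj p"
  using adj_commute by (metis successively_cong)

definition indep :: "'a set \<Rightarrow> bool" where
  "indep I \<longleftrightarrow> I \<subseteq> V \<and> (\<forall>u\<in>I. \<forall>v\<in>I. \<not> adj u v)"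

lemma indep_finite: "indep I \<Longrightarrow> finite I"
  unfolding indep_def using finite_V finite_subset by auto

lemma indep_subset: "indep I \<Longrightarrow> J \<subseteq> I \<Longrightarrow> indep J"
  unfolding indep_def by blast

lemma indep_Un:
  assumes "indep I" "indep J" "\<And>u v. u \<in> I \<Longrightarrow> v \<in> J \<Longrightarrow> \<not> adj u v"
  shows "indep (I \<union> J)"
  using assms adj_sym unfolding indep_def by blast

lemma indep_singleton: "v \<in> V \<Longrightarrow> indep {v}"
  unfolding indep_def using adj_irrefl by auto

lemma indep_extends_to_maximal:
  assumes "indep I"
  obtains J where "I \<subseteq> J" "indep J" "\<And>v. v \<in> V \<Longrightarrow> v \<notin> J \<Longrightarrow> \<exists>u\<in>J. adj v u"
proof -
  have "finite {J. indep J}"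
    using finite_V unfolding indep_def by (auto intro: finite_subset[of _ "Pow V"])
  then obtain J where J: "J \<in> {J. indep J}" "I \<subseteq> J" and
    max: "\<forall>K\<in>{J. indep J}. J \<subseteq> K \<longrightarrow> J = K"
    using finite_has_maximal2[of "{J. indep J}" I] assms by auto
  have "\<exists>u\<in>J. adj v u" if "v \<in> V" "v \<notin> J" for v
  proof (rule ccontr)
    assume "\<not> (\<exists>u\<in>J. adj v u)"
    then have "indep (J \<union> {v})"
      using J(1) that indep_singleton adj_sym by (intro indep_Un) auto
    then show False using max that by blast
  qed
  then show thesis using that[of J] J by auto
qed

definition path_in :: "'a set \<Rightarrow> 'a \<Rightarrow> 'a list \<Rightarrow> 'a \<Rightarrow> bool" where
  "path_in X a p b \<longleftrightarrow> p \<noteq> [] \<and> hd p = a \<and> last p = b \<and> set p \<subseteq> X \<and> distinct p \<and> successively adj p"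

definition separates :: "'a set \<Rightarrow> 'a set \<Rightarrow> 'a set \<Rightarrow> bool" where
  "separates S A B \<longleftrightarrow> A \<union> B \<union> S = V \<and> A \<inter> B = {} \<and> A \<inter> S = {} \<and> B \<inter> S = {} \<and> A \<noteq> {} \<and> B \<noteq> {} \<and>
    (\<forall>a\<in>A. \<forall>b\<in>B. \<not> adj a b)"

lemma path_in_mono: "path_in X a p b \<Longrightarrow> X \<subseteq> Y \<Longrightarrow> path_in Y a p b"
  unfolding path_in_def by blast

text \<open>
  The path stays in the set of vertices reachable from its start, so that it lies inside the component
  when \<open>R\<close> is adjacency outside a vertex set.
\<close>

lemma path_in_if_reachable:
  assumes "(a, b) \<in> R\<^sup>*" "R \<subseteq> {(u, v). adj u v}"
  shows "\<exists>p. path_in (R\<^sup>* `` {a}) a p b"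
  using assms(1)
proof induction
  case base
  show ?case by (intro exI[of _ "[a]"]) (simp add: path_in_def)
next
  case (step b c)
  let ?X = "R\<^sup>* `` {a}"
  obtain p where p: "path_in ?X a p b" using step by blast
  show ?case
  proof (cases "c \<in> set p")
    case True
    then obtain q r where pqr: "p = (q @ [c]) @ r"
      by (metis append.assoc append_Cons append_Nil split_list)
    have "successively adj ((q @ [c]) @ r)" using p unfolding path_in_def pqr by blast
    then have "successively adj (q @ [c])" unfolding successively_append_iff[of _ "q @ [c]" r] by blast
    then have "path_in ?X a (q @ [c]) c"
      using p unfolding path_in_def pqr by (cases q) auto
    then show ?thesis by blast
  next
    case False
    have "(a, c) \<in> R\<^sup>*" "adj b c" using step assms(2) by auto
    then have "path_in ?X a (p @ [c]) c"
      using p False by (auto simp: path_in_def successively_append_iff)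
    then show ?thesis by blast
  qed
qed

end

section \<open>A longest path and a component that it misses\<close>

locale longest_path = simple_graph +
  fixes x y :: 'a and P :: "'a list"
  assumes P_path: "path_in V x P y"
    and x_neq_y: "x \<noteq> y"
    and P_longest: "path_in V x Q y \<Longrightarrow> length Q \<le> length P"
begin

lemma P_props: "P \<noteq> []" "hd P = x" "last P = y" "set P \<subseteq> V" "distinct P" "successively adj P"
  using P_path unfolding path_in_def by auto

text \<open>
  The form in which detours and crossing chords contradict maximality: the vertices of \<open>P\<close> together with some missed vertices
  \<open>M\<close> are rearranged into a path with the same ends.
\<close>

lemma no_longer_rearrangement:
  assumes "M \<noteq> []" "set M \<subseteq> V - set P" "distinct M"
    and "mset Q = mset P + mset M" "hd Q = hd P" "last Q = last P" "successively adj Q"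
  shows False
proof -
  have "set Q = set P \<union> set M" using assms(4) by (metis set_mset_mset set_mset_union)
  moreover have "distinct Q"
    using assms(2-4) P_props(5) by (metis mset_append mset_eq_imp_distinct_iff distinct_append
        disjoint_iff subset_iff DiffD2)
  moreover have "length Q = length P + length M" using assms(4) by (metis size_mset size_union)
  moreover have "Q \<noteq> []" using assms(1,4) by auto
  ultimately show False
    using assms P_longest[of Q] P_props(2-4) unfolding path_in_def
    by (auto simp: subset_iff)
qed

lemma P_nth_eq: "i < length P \<Longrightarrow> j < length P \<Longrightarrow> P ! i = P ! j \<longleftrightarrow> i = j"
  using P_props(5) nth_eq_iff_index_eq by blast

lemma P_nth_V: "i < length P \<Longrightarrow> P ! i \<in> V"
  using P_props(4) nth_mem by blast

lemma last_P: "P ! (length P - 1) = y"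
  using P_props(1,3) last_conv_nth by metis

lemma length_P: "2 \<le> length P"
  using P_props(1-3) x_neq_y by (cases P rule: remdups_adj.cases) auto

end

locale missed_component = longest_path +
  fixes H :: "'a set"
  assumes H_nonempty: "H \<noteq> {}"
    and H_missed: "H \<subseteq> V - set P"
    and H_connected: "\<lbrakk>h \<in> H; h' \<in> H\<rbrakk> \<Longrightarrow> \<exists>M. path_in H h M h'"
    and H_closed: "\<lbrakk>h \<in> H; adj h v\<rbrakk> \<Longrightarrow> v \<in> H \<union> set P"
begin

definition attached :: "'a \<Rightarrow> bool" where
  "attached v \<longleftrightarrow> (\<exists>h\<in>H. adj h v)"

text \<open>
  A slot is the position of a neighbour of \<open>H\<close> that has a successor on \<open>P\<close>; the end \<open>y\<close> of the path is
  therefore never at a slot, even if it is adjacent to \<open>H\<close>.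
\<close>

definition slots :: "nat set" where
  "slots = {i. Suc i < length P \<and> attached (P ! i)}"

definition successors :: "'a set" where
  "successors = (\<lambda>i. P ! Suc i) ` slots"

lemma slotsD: "i \<in> slots \<Longrightarrow> Suc i < length P" "i \<in> slots \<Longrightarrow> attached (P ! i)"
  unfolding slots_def by auto

lemma finite_slots: "finite slots"
  unfolding slots_def by (rule finite_subset[of _ "{..<length P}"]) auto

lemma H_not_P: "h \<in> H \<Longrightarrow> h \<notin> set P" "h \<in> H \<Longrightarrow> h \<in> V"
  using H_missed by auto

lemma detour:
  assumes "attached u" "attached v"
  obtains M where "M \<noteq> []" "set M \<subseteq> H" "distinct M" "successively adj M"
    "adj u (hd M)" "adj (last M) v"
proof -
  obtain h h' where h: "h \<in> H" "adj h u" "h' \<in> H" "adj h' v"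
    using assms unfolding attached_def by auto
  then obtain M where "path_in H h M h'" using H_connected by blast
  then show thesis using that[of M] h adj_sym unfolding path_in_def by auto
qed

text \<open>
  Otherwise a path through \<open>H\<close> could be inserted between the two consecutive vertices.
\<close>

lemma slot_successor_not_attached:
  assumes "i \<in> slots"
  shows "\<not> attached (P ! Suc i)"
proof
  assume att: "attached (P ! Suc i)"
  obtain A B where P: "P = A @ B" "A \<noteq> []" "B \<noteq> []" "last A = P ! i" "hd B = P ! Suc i"
    using split_at_slot slotsD(1)[OF assms] by metis
  obtain M where M: "M \<noteq> []" "set M \<subseteq> H" "distinct M" "successively adj M"
    "adj (P ! i) (hd M)" "adj (last M) (P ! Suc i)"
    by (rule detour[OF slotsD(2)[OF assms] att])
  have pieces: "successively adj A" "successively adj B"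
    using P_props(6) unfolding P(1) by (simp_all add: successively_append_iff)
  have ends: "adj (last A) (hd M)" "adj (last M) (hd B)"
    unfolding P(4,5) using M(5,6) assms adj_sym by blast+
  have "successively adj (A @ M @ B)"
    using pieces ends P(2-3) M(1,4)
    by (simp add: successively_append_iff successively_Cons hd_rev last_rev)
  moreover have "mset (A @ M @ B) = mset P + mset M"
    "hd (A @ M @ B) = hd P" "last (A @ M @ B) = last P"
    using P(2-3) by (simp_all add: P(1))
  ultimately show False
    using no_longer_rearrangement[of "M" "A @ M @ B"] M(1,3)
      order_trans[OF M(2) H_missed] by blast
qed

text \<open>
  Otherwise one could leave \<open>P\<close> at slot \<open>i\<close>, run through \<open>H\<close> to slot \<open>j\<close>, go back along \<open>P\<close> to the
  successor of slot \<open>i\<close>, and jump from there to the successor of slot \<open>j\<close>.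
\<close>

lemma successors_nonadjacent:
  assumes "i \<in> slots" "j \<in> slots" "i < j"
  shows "\<not> adj (P ! Suc i) (P ! Suc j)"
proof
  assume e: "adj (P ! Suc i) (P ! Suc j)"
  obtain A B C where P: "P = A @ B @ C" "A \<noteq> []" "B \<noteq> []" "C \<noteq> []"
    "last A = P ! i" "hd B = P ! Suc i" "last B = P ! j" "hd C = P ! Suc j"
    using split_at_two_slots assms(3) slotsD(1)[OF assms(2)] by metis
  obtain M where M: "M \<noteq> []" "set M \<subseteq> H" "distinct M" "successively adj M"
    "adj (P ! i) (hd M)" "adj (last M) (P ! j)"
    by (rule detour[OF slotsD(2)[OF assms(1)] slotsD(2)[OF assms(2)]])
  have pieces: "successively adj A" "successively adj B" "successively adj C"
    using P_props(6) unfolding P(1) by (simp_all add: successively_append_iff)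
  have ends: "adj (last A) (hd M)" "adj (last M) (last B)" "adj (hd B) (hd C)"
    unfolding P(5-8) using M(5,6) assms e adj_sym by blast+
  have "successively adj (A @ M @ rev B @ C)"
    using pieces ends P(2-4) M(1,4)
    by (simp add: successively_append_iff successively_Cons hd_rev last_rev)
  moreover have "mset (A @ M @ rev B @ C) = mset P + mset M"
    "hd (A @ M @ rev B @ C) = hd P" "last (A @ M @ rev B @ C) = last P"
    using P(2-4) by (simp_all add: P(1))
  ultimately show False
    using no_longer_rearrangement[of "M" "A @ M @ rev B @ C"] M(1,3)
      order_trans[OF M(2) H_missed] by blast
qed

text \<open>
  The rotation of \<open>successors_nonadjacent\<close>, where the final jump passes through \<open>r\<close>.
\<close>

lemma no_common_neighbour_off_P:
  assumes "i \<in> slots" "j \<in> slots" "i < j" "r \<in> V" "r \<notin> set P" "r \<notin> H"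
    "adj r (P ! Suc i)" "adj r (P ! Suc j)"
  shows False
proof -
  obtain A B C where P: "P = A @ B @ C" "A \<noteq> []" "B \<noteq> []" "C \<noteq> []"
    "last A = P ! i" "hd B = P ! Suc i" "last B = P ! j" "hd C = P ! Suc j"
    using split_at_two_slots assms(3) slotsD(1)[OF assms(2)] by metis
  obtain M where M: "M \<noteq> []" "set M \<subseteq> H" "distinct M" "successively adj M"
    "adj (P ! i) (hd M)" "adj (last M) (P ! j)"
    by (rule detour[OF slotsD(2)[OF assms(1)] slotsD(2)[OF assms(2)]])
  have pieces: "successively adj A" "successively adj B" "successively adj C"
    using P_props(6) unfolding P(1) by (simp_all add: successively_append_iff)
  have ends: "adj (last A) (hd M)" "adj (last M) (last B)" "adj (hd B) r" "adj r (hd C)"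
    unfolding P(5-8) using M(5,6) assms adj_sym by blast+
  have "successively adj (A @ M @ rev B @ [r] @ C)"
    using pieces ends P(2-4) M(1,4)
    by (simp add: successively_append_iff successively_Cons hd_rev last_rev)
  moreover have "mset (A @ M @ rev B @ [r] @ C) = mset P + mset (M @ [r])"
    "hd (A @ M @ rev B @ [r] @ C) = hd P" "last (A @ M @ rev B @ [r] @ C) = last P"
    using P(2-4) by (simp_all add: P(1))
  ultimately show False
    using no_longer_rearrangement[of "M @ [r]" "A @ M @ rev B @ [r] @ C"] M(1-3) H_missed assms(4-6) by auto
qed

text \<open>
  The next three lemmas forbid certain pairs of chords from consecutive vertices of \<open>P\<close>, at positions
  \<open>l\<close> and \<open>l + 1\<close>, to the successors of two slots \<open>i < j\<close>. Which of the two chords comes from which of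
  the consecutive vertices depends on the place of \<open>l\<close> relative to the slots. In each case \<open>P\<close> is cut
  into four pieces, which are reconnected along the two chords and a path through \<open>H\<close>.
\<close>

lemma crossing_after:
  assumes "i \<in> slots" "j \<in> slots" "i < j" "j < l" "Suc l < length P"
    "adj (P ! l) (P ! Suc i)" "adj (P ! Suc l) (P ! Suc j)"
  shows False
proof -
  obtain A B C D where P: "P = A @ B @ C @ D" "A \<noteq> []" "B \<noteq> []" "C \<noteq> []" "D \<noteq> []"
    "last A = P ! i" "hd B = P ! Suc i" "last B = P ! j" "hd C = P ! Suc j"
    "last C = P ! l" "hd D = P ! Suc l"
    by (rule split_at_three_slots[OF assms(3-5)])
  obtain M where M: "M \<noteq> []" "set M \<subseteq> H" "distinct M" "successively adj M"
    "adj (P ! i) (hd M)" "adj (last M) (P ! j)"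
    by (rule detour[OF slotsD(2)[OF assms(1)] slotsD(2)[OF assms(2)]])
  have pieces: "successively adj A" "successively adj B" "successively adj C" "successively adj D"
    using P_props(6) unfolding P(1) by (simp_all add: successively_append_iff)
  have ends: "adj (last A) (hd M)" "adj (last M) (last B)" "adj (hd B) (last C)" "adj (hd C) (hd D)"
    unfolding P(6-11) using M(5,6) assms adj_sym by blast+
  have "successively adj (A @ M @ rev B @ rev C @ D)"
    using pieces ends P(2-5) M(1,4)
    by (simp add: successively_append_iff successively_Cons hd_rev last_rev)
  moreover have "mset (A @ M @ rev B @ rev C @ D) = mset P + mset M"
    "hd (A @ M @ rev B @ rev C @ D) = hd P" "last (A @ M @ rev B @ rev C @ D) = last P"
    using P(2-5) by (simp_all add: P(1))
  ultimately show False
    using no_longer_rearrangement[of "M" "A @ M @ rev B @ rev C @ D"] M(1,3)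
      order_trans[OF M(2) H_missed] by blast
qed

lemma crossing_before:
  assumes "i \<in> slots" "j \<in> slots" "l < i" "i < j"
    "adj (P ! l) (P ! Suc i)" "adj (P ! Suc l) (P ! Suc j)"
  shows False
proof -
  obtain A B C D where P: "P = A @ B @ C @ D" "A \<noteq> []" "B \<noteq> []" "C \<noteq> []" "D \<noteq> []"
    "last A = P ! l" "hd B = P ! Suc l" "last B = P ! i" "hd C = P ! Suc i"
    "last C = P ! j" "hd D = P ! Suc j"
    by (rule split_at_three_slots[OF assms(3,4) slotsD(1)[OF assms(2)]])
  obtain M where M: "M \<noteq> []" "set M \<subseteq> H" "distinct M" "successively adj M"
    "adj (P ! j) (hd M)" "adj (last M) (P ! i)"
    by (rule detour[OF slotsD(2)[OF assms(2)] slotsD(2)[OF assms(1)]])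
  have pieces: "successively adj A" "successively adj B" "successively adj C" "successively adj D"
    using P_props(6) unfolding P(1) by (simp_all add: successively_append_iff)
  have ends: "adj (last A) (hd C)" "adj (last C) (hd M)" "adj (last M) (last B)" "adj (hd B) (hd D)"
    unfolding P(6-11) using M(5,6) assms adj_sym by blast+
  have "successively adj (A @ C @ M @ rev B @ D)"
    using pieces ends P(2-5) M(1,4)
    by (simp add: successively_append_iff successively_Cons hd_rev last_rev)
  moreover have "mset (A @ C @ M @ rev B @ D) = mset P + mset M"
    "hd (A @ C @ M @ rev B @ D) = hd P" "last (A @ C @ M @ rev B @ D) = last P"
    using P(2-5) by (simp_all add: P(1))
  ultimately show False
    using no_longer_rearrangement[of "M" "A @ C @ M @ rev B @ D"] M(1,3)
      order_trans[OF M(2) H_missed] by blast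
qed

lemma crossing_between:
  assumes "i \<in> slots" "j \<in> slots" "i < l" "l < j"
    "adj (P ! l) (P ! Suc j)" "adj (P ! Suc l) (P ! Suc i)"
  shows False
proof -
  obtain A B C D where P: "P = A @ B @ C @ D" "A \<noteq> []" "B \<noteq> []" "C \<noteq> []" "D \<noteq> []"
    "last A = P ! i" "hd B = P ! Suc i" "last B = P ! l" "hd C = P ! Suc l"
    "last C = P ! j" "hd D = P ! Suc j"
    by (rule split_at_three_slots[OF assms(3,4) slotsD(1)[OF assms(2)]])
  obtain M where M: "M \<noteq> []" "set M \<subseteq> H" "distinct M" "successively adj M"
    "adj (P ! i) (hd M)" "adj (last M) (P ! j)"
    by (rule detour[OF slotsD(2)[OF assms(1)] slotsD(2)[OF assms(2)]])
  have pieces: "successively adj A" "successively adj B" "successively adj C" "successively adj D"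
    using P_props(6) unfolding P(1) by (simp_all add: successively_append_iff)
  have ends: "adj (last A) (hd M)" "adj (last M) (last C)" "adj (hd C) (hd B)" "adj (last B) (hd D)"
    unfolding P(6-11) using M(5,6) assms adj_sym by blast+
  have "successively adj (A @ M @ rev C @ B @ D)"
    using pieces ends P(2-5) M(1,4)
    by (simp add: successively_append_iff successively_Cons hd_rev last_rev)
  moreover have "mset (A @ M @ rev C @ B @ D) = mset P + mset M"
    "hd (A @ M @ rev C @ B @ D) = hd P" "last (A @ M @ rev C @ B @ D) = last P"
    using P(2-5) by (simp_all add: P(1))
  ultimately show False
    using no_longer_rearrangement[of "M" "A @ M @ rev C @ B @ D"] M(1,3)
      order_trans[OF M(2) H_missed] by blast
qed

lemma inj_on_slots: "inj_on (\<lambda>i. P ! Suc i) slots"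
proof (rule inj_onI)
  fix i j assume "i \<in> slots" "j \<in> slots" "P ! Suc i = P ! Suc j"
  then show "i = j" using P_nth_eq[of "Suc i" "Suc j"] slotsD(1) by blast
qed

lemma card_successors: "card successors = card slots"
  unfolding successors_def by (rule card_image[OF inj_on_slots])

lemma successors_on_P: "successors \<subseteq> set P"
  unfolding successors_def using slotsD(1) by auto

lemma indep_successors: "indep successors"
proof -
  have "\<not> adj (P ! Suc i) (P ! Suc j)" if "i \<in> slots" "j \<in> slots" for i j
    using successors_nonadjacent that adj_sym adj_irrefl by (metis linorder_neqE_nat)
  then show ?thesis
    unfolding indep_def using successors_on_P P_props(4) by (fastforce simp: successors_def)
qed

lemma successors_H_nonadjacent: "s \<in> successors \<Longrightarrow> h \<in> H \<Longrightarrow> \<not> adj s h"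
  using slot_successor_not_attached adj_sym unfolding successors_def attached_def by blast

text \<open>
  The main source of large independent sets: the successors and any independent set inside \<open>H\<close> do not
  interfere.
\<close>

lemma indep_successors_Un:
  assumes "indep I" "I \<subseteq> H"
  shows "indep (successors \<union> I)" "card (successors \<union> I) = card slots + card I"
proof -
  show "indep (successors \<union> I)"
    using indep_successors assms successors_H_nonadjacent by (intro indep_Un) auto
  have "successors \<inter> I = {}" using successors_on_P assms(2) H_not_P(1) by blast
  then show "card (successors \<union> I) = card slots + card I"
    using card_Un_disjoint indep_finite assms(1) indep_successors card_successors by metis
qed

end

section \<open>Graphs without an induced edge and k isolated vertices\<close>

locale K2_kK1_free = simple_graph +
  fixes k :: nat
  assumes free: "\<lbrakk>adj u v; indep I; \<And>w. w \<in> I \<Longrightarrow> \<not> adj u w \<and> \<not> adj v w\<rbrakk> \<Longrightarrow> card I < k"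
begin

text \<open>
  The members of \<open>J\<close> that \<open>v\<close> misses are nonadjacent to both ends of the edge between \<open>v\<close> and \<open>u\<close>.
\<close>

lemma few_missed:
  assumes "indep J" "u \<in> J" "adj v u"
  shows "card {w \<in> J. \<not> adj v w} < k"
  using assms by (intro free[OF assms(3)] indep_subset[OF assms(1)]) (auto simp: indep_def)

end

locale missed_component_in_free = missed_component + K2_kK1_free
begin

section \<open>Components with a single vertex\<close>

text \<open>
  Of two consecutive vertices of \<open>P\<close> outside \<open>J\<close>, each misses at most \<open>k - 1\<close> vertices of \<open>J\<close>, and the
  first one misses \<open>h\<close>, so that it misses at most \<open>k - 2\<close> successors. Of at least \<open>2 * k - 1\<close> successors
  there remain two that are adjacent to both, which is just what the crossing lemmas need.
\<close>

lemma component_not_singleton: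
  assumes "H = {h}"
    and degree: "2 * k \<le> card {w. adj h w}"
    and alpha: "\<And>I. indep I \<Longrightarrow> 2 * card I < card V"
  shows False
proof -
  let ?n = "length P"
  have att: "attached v \<longleftrightarrow> adj h v" for v unfolding attached_def using assms(1) by simp
  have hV: "h \<in> V" "h \<notin> set P" using H_not_P assms(1) by auto
  have "{w. adj h w} \<subseteq> (!) P ` insert (?n - 1) slots"
  proof
    fix w assume "w \<in> {w. adj h w}"
    then have "adj h w" "w \<in> set P" using H_closed[of h w] adj_irrefl[of h] assms(1) by auto
    then obtain i where i: "i < ?n" "w = P ! i" by (auto simp: in_set_conv_nth)
    then have "i = ?n - 1 \<or> i \<in> slots" using \<open>adj h w\<close> att unfolding slots_def by auto
    then show "w \<in> (!) P ` insert (?n - 1) slots" using i by auto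
  qed
  then have "card {w. adj h w} \<le> card (insert (?n - 1) slots)"
    by (meson card_image_le card_mono finite.insertI finite_imageI finite_slots le_trans)
  also have "\<dots> \<le> Suc (card slots)" by (simp add: card_insert_le_m1 card_insert_if finite_slots)
  finally have many_slots: "2 * k \<le> Suc (card slots)" using degree by simp
  have "indep (successors \<union> {h})"
    using indep_successors_Un(1)[OF indep_singleton[OF hV(1)]] assms(1) by simp
  then obtain J where J: "successors \<union> {h} \<subseteq> J" "indep J"
    and J_max: "\<And>v. v \<in> V \<Longrightarrow> v \<notin> J \<Longrightarrow> \<exists>u\<in>J. adj v u"
    using indep_extends_to_maximal by metis
  \<comment> \<open>The slots whose successors \<open>v\<close> misses; a nonadjacent \<open>h\<close> uses up one further missed vertex of \<open>J\<close>.\<close>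
  define bad where "bad v = {i \<in> slots. \<not> adj v (P ! Suc i)}" for v
  have fin_bad: "finite (bad v)" for v unfolding bad_def using finite_slots by simp
  have missed: "card (bad v) + (if adj v h then 0 else 1) < k" if v: "v \<in> V" "v \<notin> J" for v
  proof -
    let ?M = "(\<lambda>i. P ! Suc i) ` bad v"
    obtain u where "u \<in> J" "adj v u" using J_max[OF v] by blast
    then have *: "card {w \<in> J. \<not> adj v w} < k" using few_missed J(2) by blast
    have fin: "finite {w \<in> J. \<not> adj v w}" using indep_finite[OF J(2)] by simp
    have sub: "?M \<subseteq> {w \<in> J. \<not> adj v w}" using J(1) by (auto simp: bad_def successors_def)
    have card: "card ?M = card (bad v)"
      by (rule card_image[OF inj_on_subset[OF inj_on_slots]]) (auto simp: bad_def)
    have "h \<notin> ?M"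
      using successors_on_P hV(2) by (auto simp: bad_def successors_def)
    then have "card (insert h ?M) = Suc (card (bad v))"
      using card fin_bad by simp
    moreover have "card (insert h ?M) \<le> card {w \<in> J. \<not> adj v w}" if "\<not> adj v h"
      using that sub J(1) by (intro card_mono[OF fin]) auto
    moreover have "card ?M \<le> card {w \<in> J. \<not> adj v w}" by (rule card_mono[OF fin sub])
    ultimately show ?thesis using * card by auto
  qed
  have off_P: "r \<in> J" if "r \<in> V" "r \<notin> set P" for r
  proof (rule ccontr)
    assume "r \<notin> J"
    then have "r \<noteq> h" using J(1) by auto
    then have "\<not> adj r h" using H_closed[of h r] that assms(1) adj_sym by auto
    then have "card (bad r) + 1 < k" using missed[of r] \<open>r \<notin> J\<close> that(1) by simp
    moreover have "card slots - card (bad r) \<le> card (slots - bad r)"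
      by (rule diff_card_le_card_Diff[OF fin_bad])
    ultimately have "2 \<le> card (slots - bad r)" using many_slots by linarith
    then obtain i j where "i \<in> slots - bad r" "j \<in> slots - bad r" "i < j"
      by (rule two_of_card_ge_2)
    then show False
      using no_common_neighbour_off_P[of i j r] that \<open>r \<noteq> h\<close> assms(1) by (auto simp: bad_def)
  qed
  have alternate: "P ! l \<in> J \<or> P ! Suc l \<in> J" if l: "Suc l < ?n" for l
  proof (rule ccontr)
    assume out: "\<not> (P ! l \<in> J \<or> P ! Suc l \<in> J)"
    \<comment> \<open>If \<open>P ! l\<close> were adjacent to \<open>h\<close>, then \<open>P ! Suc l\<close> would be a successor and hence in \<open>J\<close>.\<close>
    have "l \<notin> slots" using J(1) out by (auto simp: successors_def)
    then have "\<not> adj (P ! l) h" using att l adj_sym unfolding slots_def by blast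
    then have 1: "card (bad (P ! l)) + 1 < k" using missed[of "P ! l"] out P_nth_V l by auto
    have 2: "card (bad (P ! Suc l)) < k" using missed[of "P ! Suc l"] out P_nth_V l by auto
    let ?good = "slots - (bad (P ! l) \<union> bad (P ! Suc l))"
    have "card slots - card (bad (P ! l) \<union> bad (P ! Suc l)) \<le> card ?good"
      by (rule diff_card_le_card_Diff) (simp add: fin_bad)
    moreover have "card (bad (P ! l) \<union> bad (P ! Suc l)) \<le> card (bad (P ! l)) + card (bad (P ! Suc l))"
      by (rule card_Un_le)
    ultimately have "2 \<le> card ?good" using 1 2 many_slots by linarith
    then obtain i j where ij: "i \<in> ?good" "j \<in> ?good" "i < j" by (rule two_of_card_ge_2)
    then have S: "i \<in> slots" "j \<in> slots"
      and A: "adj (P ! l) (P ! Suc i)" "adj (P ! Suc l) (P ! Suc i)"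
        "adj (P ! l) (P ! Suc j)" "adj (P ! Suc l) (P ! Suc j)"
      by (auto simp: bad_def)
    consider "j < l" | "l < i" | "i < l" "l < j"
      using S \<open>l \<notin> slots\<close> by (metis linorder_neqE_nat)
    then show False
    proof cases
      case 1 then show ?thesis using crossing_after[OF S ij(3) _ l A(1) A(4)] by blast
    next
      case 2 then show ?thesis using crossing_before[OF S _ ij(3) A(1) A(4)] by blast
    next
      case 3 then show ?thesis using crossing_between[OF S _ _ A(3) A(2)] by blast
    qed
  qed
  \<comment> \<open>At most one more vertex of \<open>P\<close> is outside \<open>J\<close> than inside, and \<open>h\<close> makes up for it.\<close>
  have "successively (\<lambda>a b. a \<in> J \<or> b \<in> J) P"
    using alternate by (simp add: successively_conv_nth)
  then have "length (filter (\<lambda>a. a \<notin> J) P) \<le> Suc (length (filter (\<lambda>a. a \<in> J) P))"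
    by (rule few_failures_if_no_two_consecutive)
  moreover have "{a. a \<notin> J} \<inter> set P = V - J" using off_P P_props(4) by blast
  then have "length (filter (\<lambda>a. a \<notin> J) P) = card (V - J)"
    using distinct_length_filter[OF P_props(5), of "\<lambda>a. a \<notin> J"] by simp
  moreover have "Suc (length (filter (\<lambda>a. a \<in> J) P)) \<le> card J"
  proof -
    have "length (filter (\<lambda>a. a \<in> J) P) = card (J \<inter> set P)"
      using distinct_length_filter[OF P_props(5)] by simp
    also have "\<dots> < card J"
      using J(1) hV(2) indep_finite[OF J(2)] by (intro psubset_card_mono) auto
    finally show ?thesis by simp
  qed
  moreover have "card V = card (V - J) + card J"
  proof -
    have "J \<subseteq> V" using J(2) unfolding indep_def by blast
    then show ?thesis using card_Diff_subset[of J V] card_mono[of V J] finite_V indep_finite[OF J(2)] by simp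
  qed
  ultimately show False using alpha[OF J(2)] by linarith
qed

end

section \<open>Components with an edge\<close>

locale missed_component_with_edge = missed_component_in_free +
  fixes e e' :: 'a
  assumes edge: "e \<in> H" "e' \<in> H" "adj e e'"
    and separation: "separates S A B \<Longrightarrow> k \<le> card S"
begin

definition attachments :: "'a set" where
  "attachments = {v \<in> set P. attached v}"

text \<open>
  The side opposite to \<open>H\<close> of the cut formed by the neighbours of \<open>H\<close>. It comprises the remaining
  vertices of \<open>P\<close> and also all other components of \<open>G - P\<close>.
\<close>

definition remainder :: "'a set" where
  "remainder = V - (H \<union> attachments)"

lemma H_remainder_nonadjacent: "h \<in> H \<Longrightarrow> b \<in> remainder \<Longrightarrow> \<not> adj h b"
  using H_closed unfolding remainder_def attachments_def attached_def by blast

text \<open>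
  The remainder is nonadjacent to both ends of the edge in \<open>H\<close>.
\<close>

lemma card_indep_remainder:
  assumes "indep I" "I \<subseteq> remainder"
  shows "card I < k"
  using free[OF edge(3) assms(1)] H_remainder_nonadjacent edge assms(2) by blast

text \<open>
  Two consecutive vertices of \<open>P\<close> cannot both be adjacent to \<open>H\<close>, so one of the first two vertices of
  \<open>P\<close> is in the remainder.
\<close>

lemma remainder_nonempty: "remainder \<noteq> {}"
proof (cases "attached (P ! 0)")
  case True
  have P1: "Suc 0 < length P" using length_P by simp
  then have "\<not> attached (P ! 1)"
    using slot_successor_not_attached[of 0] True by (simp add: slots_def)
  then have "P ! 1 \<in> remainder"
    using P_nth_V H_not_P(1) P1 unfolding remainder_def attachments_def by force
  then show ?thesis by blast
next
  case False
  have "0 < length P" using length_P by linarith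
  then have "P ! 0 \<in> remainder"
    using P_nth_V H_not_P(1) False unfolding remainder_def attachments_def by force
  then show ?thesis by blast
qed

lemma k_ge_2: "2 \<le> k"
proof -
  obtain b where b: "b \<in> remainder" using remainder_nonempty by blast
  then have "indep {b}" by (intro indep_singleton) (auto simp: remainder_def)
  then show ?thesis using card_indep_remainder[of "{b}"] b by simp
qed

lemma successors_remainder: "successors \<subseteq> remainder"
proof
  fix s assume s: "s \<in> successors"
  then have "s \<in> set P" "\<not> attached s"
    using successors_on_P slot_successor_not_attached by (auto simp: successors_def)
  then show "s \<in> remainder"
    using H_not_P(1) P_props(4) unfolding remainder_def attachments_def by blast
qed

lemma card_slots_less: "card slots < k"
  using card_indep_remainder[OF indep_successors successors_remainder] card_successors by simp

lemma attachments_subset: "attachments \<subseteq> insert y ((!) P ` slots)"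
proof
  fix v assume "v \<in> attachments"
  then obtain i where i: "i < length P" "v = P ! i" "attached v"
    unfolding attachments_def by (auto simp: in_set_conv_nth)
  then have "i = length P - 1 \<or> i \<in> slots" unfolding slots_def by auto
  then show "v \<in> insert y ((!) P ` slots)" using i last_P by auto
qed

lemma finite_attachments: "finite attachments"
  unfolding attachments_def by simp

lemma k_le_card_attachments: "k \<le> card attachments"
proof (rule separation)
  show "separates attachments H remainder"
    unfolding separates_def
  proof (intro conjI ballI)
    show "H \<union> remainder \<union> attachments = V"
      unfolding remainder_def using H_missed P_props(4) by (auto simp: attachments_def)
    show "H \<inter> attachments = {}" using H_not_P(1) by (auto simp: attachments_def)
  qed (use H_nonempty remainder_nonempty H_remainder_nonadjacent in \<open>auto simp: remainder_def\<close>)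
qed

lemma card_slots_image: "card ((!) P ` slots) \<le> card slots"
  by (rule card_image_le[OF finite_slots])

text \<open>
  The cut has at least \<open>k\<close> vertices, but fewer than \<open>k\<close> of them are at slots. So the only other possible
  neighbour of \<open>H\<close>, the end \<open>y\<close>, is one.
\<close>

lemma y_attached: "attached y"
proof (rule ccontr)
  assume "\<not> attached y"
  then have "attachments \<subseteq> (!) P ` slots"
    using attachments_subset by (auto simp: attachments_def)
  then have "card attachments \<le> card ((!) P ` slots)"
    using finite_slots by (intro card_mono) auto
  then show False using k_le_card_attachments card_slots_image card_slots_less by linarith
qed

lemma card_attachments: "card attachments = k" and card_slots: "Suc (card slots) = k"
proof -
  have "card attachments \<le> card (insert y ((!) P ` slots))"
    using attachments_subset finite_slots by (intro card_mono) auto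
  also have "\<dots> \<le> Suc (card ((!) P ` slots))"
    using finite_slots by (simp add: card_insert_if)
  finally have "card attachments \<le> Suc (card slots)" using card_slots_image by linarith
  then show "card attachments = k" "Suc (card slots) = k"
    using k_le_card_attachments card_slots_less by linarith+
qed

text \<open>
  A vertex \<open>z\<close> missed by an edge of \<open>H\<close> would form, with the \<open>k - 1\<close> successors, an independent set of
  size \<open>k\<close> nonadjacent to that edge. In other words, \<open>H\<close> is complete multipartite.
\<close>

lemma edge_dominates_component:
  assumes "h \<in> H" "h' \<in> H" "adj h h'" "z \<in> H"
  shows "adj z h \<or> adj z h'"
proof (rule ccontr)
  assume z: "\<not> (adj z h \<or> adj z h')"
  have "indep {z}" using indep_singleton H_not_P(2) assms(4) by blast
  then have W: "indep (successors \<union> {z})" "card (successors \<union> {z}) = k"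
    using indep_successors_Un[of "{z}"] assms(4) card_slots by auto
  have "card (successors \<union> {z}) < k"
    using free[OF assms(3) W(1)] z assms(1,2) successors_H_nonadjacent adj_sym by blast
  then show False using W(2) by simp
qed

text \<open>
  Extend a path from \<open>a\<close> in \<open>H - b\<close> as long as possible. All neighbours in \<open>H - b\<close> of its end \<open>c\<close> are on
  it, so it has at least \<open>k\<close> vertices. If \<open>c\<close> is not adjacent to \<open>b\<close>, then its predecessor is, because
  the last edge dominates \<open>b\<close>; dropping \<open>c\<close> and adding \<open>b\<close> keeps the number of vertices.
\<close>

lemma long_path_in_component:
  assumes ab: "a \<in> H" "b \<in> H" "a \<noteq> b"
    and degree: "\<And>v. v \<in> V \<Longrightarrow> 2 * k \<le> card {w. adj v w}"
  obtains M where "path_in H a M b" "k \<le> length M"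
proof -
  have finH: "finite H" using H_missed finite_V finite_subset by blast
  have inner_degree: "k \<le> card {w \<in> H. adj v w}" if "v \<in> H" for v
  proof -
    have "{w. adj v w} \<subseteq> {w \<in> H. adj v w} \<union> attachments"
      using that H_closed unfolding attachments_def attached_def by blast
    then have "card {w. adj v w} \<le> card ({w \<in> H. adj v w} \<union> attachments)"
      using finH finite_attachments by (intro card_mono) auto
    also have "\<dots> \<le> card {w \<in> H. adj v w} + card attachments" by (rule card_Un_le)
    finally show ?thesis using degree[of v] H_not_P(2)[OF that] card_attachments by linarith
  qed
  let ?X = "H - {b}"
  define good where "good M \<longleftrightarrow> (\<exists>c. path_in ?X a M c)" for M
  have "good [a]" using ab by (auto simp: good_def path_in_def)
  moreover have "\<forall>M. good M \<longrightarrow> length M < Suc (card H)"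
  proof (intro allI impI)
    fix M assume "good M"
    then have "set M \<subseteq> H" "distinct M" unfolding good_def path_in_def by auto
    then show "length M < Suc (card H)"
      using distinct_card card_mono[OF finH] by (metis le_imp_less_Suc)
  qed
  ultimately obtain M where M: "good M" and M_max: "\<forall>N. good N \<longrightarrow> length N \<le> length M"
    using ex_has_greatest_nat[of good "[a]" length "Suc (card H)"] by blast
  then obtain c where c: "path_in ?X a M c" unfolding good_def by blast
  then have cM: "c \<in> set M" "c \<in> H" "c \<noteq> b" "M \<noteq> []" "last M = c" "distinct M"
    "successively adj M" "hd M = a" "set M \<subseteq> ?X"
    unfolding path_in_def by (auto dest: last_in_set)
  have nbrs: "{w \<in> H. adj c w} - {b} \<subseteq> set M - {c}"
  proof
    fix w assume w: "w \<in> {w \<in> H. adj c w} - {b}"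
    have "w \<in> set M"
    proof (rule ccontr)
      assume "w \<notin> set M"
      then have "path_in ?X a (M @ [w]) w"
        using c w unfolding path_in_def by (auto simp: successively_append_iff)
      then show False using M_max unfolding good_def by fastforce
    qed
    then show "w \<in> set M - {c}" using w adj_irrefl by auto
  qed
  have "k - 1 \<le> card ({w \<in> H. adj c w} - {b})"
    using inner_degree[OF cM(2)] diff_card_le_card_Diff[of "{b}" "{w \<in> H. adj c w}"] by simp
  also have "\<dots> \<le> card (set M - {c})" using nbrs by (intro card_mono) auto
  also have "\<dots> = length M - 1" using cM by (simp add: distinct_card)
  finally have lenM: "k \<le> length M" using cM(4) k_ge_2 by (cases M) auto
  show thesis
  proof (cases "adj c b")
    case True
    then have "path_in H a (M @ [b]) b"
      using c ab(2) unfolding path_in_def by (auto simp: successively_append_iff)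
    then show thesis using that[of "M @ [b]"] lenM by simp
  next
    case False
    obtain N where N: "M = N @ [c]" using cM(4,5) by (metis append_butlast_last_id)
    have "N \<noteq> []" using lenM k_ge_2 N by (cases N) auto
    have "last N \<in> set M" using \<open>N \<noteq> []\<close> unfolding N by simp
    then have N2: "last N \<in> H" "adj (last N) c"
      using cM(7,9) \<open>N \<noteq> []\<close> unfolding N by (blast, simp add: successively_append_iff)
    have "adj b (last N)"
      using edge_dominates_component[OF N2(1) cM(2) N2(2) ab(2)] False adj_sym by blast
    then have "path_in H a (N @ [b]) b"
      using cM(6-9) ab(2) \<open>N \<noteq> []\<close> adj_sym unfolding path_in_def N
      by (auto simp: successively_append_iff)
    then show thesis using that[of "N @ [b]"] lenM N by simp
  qed
qed

definition last_slot :: nat where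
  "last_slot = Max slots"

lemma last_slot: "last_slot \<in> slots" "i \<in> slots \<Longrightarrow> i \<le> last_slot"
proof -
  have "slots \<noteq> {}" using card_slots k_ge_2 by auto
  then show "last_slot \<in> slots" "i \<in> slots \<Longrightarrow> i \<le> last_slot"
    unfolding last_slot_def using finite_slots by auto
qed

text \<open>
  A vertex \<open>a\<close> between the successor of the last slot and \<open>y\<close> is in the remainder, where no \<open>k\<close> vertices are
  independent, so it has a neighbour among the \<open>k - 1\<close> successors. If it had just one, \<open>s\<close>, then the
  other \<open>k - 2\<close> successors with \<open>h1\<close> and \<open>h2\<close> would be \<open>k\<close> independent vertices nonadjacent to both ends
  of the edge between \<open>a\<close> and \<open>s\<close>.
\<close>

lemma two_successor_neighbours:
  assumes "h1 \<in> H" "h2 \<in> H" "h1 \<noteq> h2" "\<not> adj h1 h2"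
    and "Suc last_slot < l" "Suc l < length P"
  shows "2 \<le> card {i \<in> slots. adj (P ! l) (P ! Suc i)}"
proof (rule ccontr)
  let ?N = "{i \<in> slots. adj (P ! l) (P ! Suc i)}"
  assume "\<not> 2 \<le> card ?N"
  then have small: "card ?N \<le> Suc 0" by simp
  have l: "\<not> attached (P ! l)" using last_slot(2)[of l] assms(5,6) by (auto simp: slots_def)
  then have lH: "\<not> adj (P ! l) h" if "h \<in> H" for h
    using that adj_sym unfolding attached_def by blast
  have lr: "P ! l \<in> remainder"
    using l P_nth_V[of l] H_not_P(1)[of "P ! l"] nth_mem[of l P] assms(6)
    unfolding remainder_def attachments_def by auto
  have ls: "P ! l \<notin> successors"
  proof
    assume "P ! l \<in> successors"
    then obtain i where i: "i \<in> slots" "P ! l = P ! Suc i" by (auto simp: successors_def)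
    then have "l = Suc i" using P_nth_eq[of l "Suc i"] slotsD(1) assms(6) by simp
    then show False using last_slot(2)[OF i(1)] assms(5) by simp
  qed
  obtain i where i: "i \<in> ?N"
  proof (cases "?N = {}")
    case True
    then have no: "\<not> adj s (P ! l)" if "s \<in> successors" for s
      using that adj_sym by (auto simp: successors_def)
    have "indep (successors \<union> {P ! l})"
      using no lr by (intro indep_Un indep_successors indep_singleton) (auto simp: remainder_def)
    moreover have "successors \<union> {P ! l} \<subseteq> remainder" using successors_remainder lr by simp
    ultimately have "card (successors \<union> {P ! l}) < k" using card_indep_remainder by blast
    moreover have "card (successors \<union> {P ! l}) = k"
      using ls card_successors card_slots indep_finite[OF indep_successors] by simp
    ultimately show thesis by simp
  qed (use that in blast)
  then have N: "?N = {i}" using small finite_slots by (simp add: card_le_Suc0_iff_eq) blast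
  let ?W = "successors \<union> {h1, h2}"
  let ?s = "P ! Suc i"
  have "indep {h1, h2}"
    using assms(1-4) adj_sym adj_irrefl H_not_P(2) unfolding indep_def by auto
  then have W: "indep ?W" "card ?W = Suc k"
    using indep_successors_Un[of "{h1, h2}"] assms(1-3) card_slots by auto
  have s: "?s \<in> ?W" "adj (P ! l) ?s" using i by (auto simp: successors_def)
  have "card (?W - {?s}) < k"
  proof (rule free[OF s(2) indep_subset[OF W(1)]])
    fix w assume w: "w \<in> ?W - {?s}"
    have "\<not> adj (P ! l) w" if "w \<in> successors"
      using that w N by (auto simp: successors_def)
    moreover have "\<not> adj ?s w" using w s(1) W(1) unfolding indep_def by blast
    ultimately show "\<not> adj (P ! l) w \<and> \<not> adj ?s w" using w lH assms(1,2) by blast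
  qed blast
  moreover have "card (?W - {?s}) = k"
    using W(2) s(1) by (simp add: card_Diff_singleton)
  ultimately show False by simp
qed

text \<open>
  Let \<open>N l\<close> be the set of slots to whose successors \<open>P ! l\<close> is adjacent. All slots precede the last
  segment, so \<open>crossing_after\<close> shows that every member of \<open>N (Suc l)\<close> is at most every member of
  \<open>N l\<close>. As these sets have two elements each, their minima decrease strictly along the segment, and
  there are only \<open>k - 1\<close> slots.
\<close>

lemma last_segment_short:
  assumes "h1 \<in> H" "h2 \<in> H" "h1 \<noteq> h2" "\<not> adj h1 h2"
  shows "length P \<le> last_slot + k + 1"
proof (rule ccontr)
  assume long: "\<not> length P \<le> last_slot + k + 1"
  define N where "N l = {i \<in> slots. adj (P ! l) (P ! Suc i)}" for l
  define f where "f l = Min (N l)" for l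
  have finN: "finite (N l)" for l unfolding N_def using finite_slots by simp
  have two: "\<exists>i j. i \<in> N l \<and> j \<in> N l \<and> i < j" if "Suc last_slot < l" "Suc l < length P" for l
    by (rule two_of_card_ge_2[OF two_successor_neighbours[OF assms that]]) (auto simp: N_def)
  have f: "f l \<in> N l" "i \<in> N l \<Longrightarrow> f l \<le> i" if "Suc last_slot < l" "Suc l < length P" for l i
    using two[OF that] finN[of l] unfolding f_def by (auto intro: Min_in)
  have f_beaten: "\<exists>j\<in>N l. f l < j" if l: "Suc last_slot < l" "Suc l < length P" for l
  proof -
    obtain i j where "i \<in> N l" "j \<in> N l" "i < j" using two[OF l] by blast
    then have "f l < j" using f(2)[OF l, of i] by simp
    then show ?thesis using \<open>j \<in> N l\<close> by blast
  qed
  have decrease: "f (Suc l) < f l" if l: "Suc last_slot < l" "Suc (Suc l) < length P" for l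
  proof -
    obtain j where j: "j \<in> N (Suc l)" "f (Suc l) < j" using f_beaten[of "Suc l"] l by auto
    have fl: "f l \<in> N l" using f(1)[of l] l by simp
    have "\<not> f l < j"
    proof
      assume "f l < j"
      moreover have "j < l" using last_slot(2)[of j] j(1) l(1) by (auto simp: N_def)
      ultimately show False
        using crossing_after[of "f l" j l] fl j(1) l(2) by (auto simp: N_def)
    qed
    then show ?thesis using j(2) by simp
  qed
  \<comment> \<open>The summand 2 accounts for the first minimum itself and for a larger slot above it.\<close>
  have count: "card {i \<in> slots. i < f (last_slot + 2 + t)} + t + 2 \<le> card slots"
    if "last_slot + 3 + t < length P" for t
    using that
  proof (induction t)
    case 0
    let ?l = "last_slot + 2"
    have l: "Suc last_slot < ?l" "Suc ?l < length P" using 0 by auto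
    obtain j where j: "j \<in> N ?l" "f ?l < j" using f_beaten[OF l] by blast
    have "card {i \<in> slots. i < f ?l} + 2 = card ({i \<in> slots. i < f ?l} \<union> {f ?l, j})"
      using j finite_slots by (subst card_Un_disjoint) auto
    also have "\<dots> \<le> card slots"
      using j f(1)[OF l] finite_slots by (intro card_mono) (auto simp: N_def)
    finally show ?case by simp
  next
    case (Suc t)
    let ?l = "last_slot + 2 + t"
    have less: "f (Suc ?l) < f ?l" using decrease[of ?l] Suc(2) by simp
    have "f (Suc ?l) \<in> slots" using f(1)[of "Suc ?l"] Suc(2) by (simp add: N_def)
    then have "card {i \<in> slots. i < f (Suc ?l)} < card {i \<in> slots. i < f ?l}"
      using less finite_slots by (intro psubset_card_mono) auto
    then show ?case using Suc by simp
  qed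
  have "last_slot + 3 + (length P - last_slot - 4) < length P"
    using long k_ge_2 by linarith
  then show False using count[of "length P - last_slot - 4"] card_slots long by linarith
qed

text \<open>
  If the two ends of the last segment had only one vertex \<open>h\<close> of \<open>H\<close> as a neighbour, then \<open>h\<close> could
  replace both of them in the cut, leaving fewer than \<open>k\<close> vertices.
\<close>

lemma distinct_gates:
  obtains h h' where "h \<in> H" "h' \<in> H" "h \<noteq> h'" "adj (P ! last_slot) h" "adj h' y"
proof -
  let ?u = "P ! last_slot"
  have u: "attached ?u" "?u \<in> set P" using slotsD[OF last_slot(1)] by auto
  have y: "y \<in> set P" using P_props(1,3) by auto
  have uy: "?u \<noteq> y" using last_P P_nth_eq[of last_slot "length P - 1"] slotsD(1)[OF last_slot(1)]
    by auto
  obtain h where h: "h \<in> H" "adj h ?u" using u(1) unfolding attached_def by blast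
  obtain h' where h': "h' \<in> H" "adj h' y" using y_attached unfolding attached_def by blast
  show thesis
  proof (cases "\<exists>g\<in>H. \<exists>g'\<in>H. g \<noteq> g' \<and> adj g ?u \<and> adj g' y")
    case True
    then show thesis using that adj_sym by blast
  next
    case False
    have only: "g = h" if "g \<in> H" "adj g ?u \<or> adj g y" for g
      using False that h h' by metis
    let ?S = "insert h (attachments - {?u, y})"
    have "separates ?S (H - {h}) (remainder \<union> {?u, y})"
      unfolding separates_def
    proof (intro conjI ballI)
      show "(H - {h}) \<union> (remainder \<union> {?u, y}) \<union> ?S = V"
        using H_missed P_props(4) u(2) y h(1) by (auto simp: remainder_def attachments_def)
      show "(H - {h}) \<inter> (remainder \<union> {?u, y}) = {}" "(H - {h}) \<inter> ?S = {}"
        "(remainder \<union> {?u, y}) \<inter> ?S = {}"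
        using H_not_P(1) u(2) y h(1) by (auto simp: remainder_def attachments_def)
      show "H - {h} \<noteq> {}" using edge adj_irrefl by blast
      show "\<not> adj a b" if "a \<in> H - {h}" "b \<in> remainder \<union> {?u, y}" for a b
        using that H_remainder_nonadjacent only by blast
    qed simp
    then have "k \<le> card ?S" by (rule separation)
    moreover have "card (attachments - {?u, y}) = k - 2"
      using u y y_attached uy card_attachments
      by (subst card_Diff_subset) (auto simp: attachments_def)
    then have "card ?S \<le> Suc (k - 2)"
      using finite_attachments by (simp add: card_insert_if)
    ultimately show thesis using k_ge_2 by linarith
  qed
qed

text \<open>
  An independent set has at most \<open>k\<close> vertices in the cut and at most \<open>k - 1\<close> in the remainder. Beyond
  \<open>2 * k\<close> vertices it therefore contains two nonadjacent vertices of \<open>H\<close>; the last segment of \<open>P\<close> is then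
  short enough to be replaced profitably by a path through \<open>H\<close>.
\<close>

lemma independent_sets_small:
  assumes degree: "\<And>v. v \<in> V \<Longrightarrow> 2 * k \<le> card {w. adj v w}"
    and I: "indep I"
  shows "card I \<le> 2 * k"
proof (rule ccontr)
  assume "\<not> card I \<le> 2 * k"
  have "I = (I \<inter> H) \<union> (I \<inter> attachments) \<union> (I \<inter> remainder)"
    using I unfolding indep_def remainder_def by blast
  then have "card I \<le> card (I \<inter> H) + card (I \<inter> attachments) + card (I \<inter> remainder)"
    by (metis add_le_mono1 card_Un_le le_trans)
  moreover have "card (I \<inter> attachments) \<le> k"
    using card_mono[OF finite_attachments, of "I \<inter> attachments"] card_attachments by simp
  moreover have "card (I \<inter> remainder) < k"
    by (rule card_indep_remainder[OF indep_subset[OF I]]) auto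
  ultimately have "2 \<le> card (I \<inter> H)" using \<open>\<not> card I \<le> 2 * k\<close> by linarith
  then obtain T where "T \<subseteq> I \<inter> H" "card T = 2" by (metis obtain_subset_with_card_n)
  then obtain h1 h2 where h12: "h1 \<in> H" "h2 \<in> H" "h1 \<noteq> h2" "\<not> adj h1 h2"
    using I unfolding indep_def by (auto simp: card_2_iff)
  obtain h h' where h: "h \<in> H" "h' \<in> H" "h \<noteq> h'" "adj (P ! last_slot) h" "adj h' y"
    by (rule distinct_gates)
  obtain M where M: "path_in H h M h'" "k \<le> length M"
    using long_path_in_component[OF h(1-3) degree] by blast
  obtain A B where P: "P = A @ B" "A \<noteq> []" "B \<noteq> []" "last A = P ! last_slot"
    "hd B = P ! Suc last_slot" "length A = Suc last_slot"
    by (rule split_at_slot[OF slotsD(1)[OF last_slot(1)]])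
  have A: "successively adj A" "distinct A" "y \<notin> set A" "set A \<subseteq> set P"
    using P_props(3,5,6) P(2,3) unfolding P(1) by (auto simp: successively_append_iff)
  have y: "y \<in> set P" using P_props(1,3) by auto
  have dis: "set M \<inter> set P = {}" using M(1) H_not_P(1) unfolding path_in_def by blast
  have "path_in V x (A @ M @ [y]) y"
    unfolding path_in_def
  proof (intro conjI)
    show "hd (A @ M @ [y]) = x" using P_props(2) P(2) unfolding P(1) by simp
    show "set (A @ M @ [y]) \<subseteq> V"
      using A(4) y P_props(4) M(1) H_not_P(2) unfolding path_in_def by auto
    show "distinct (A @ M @ [y])" using A y dis M(1) unfolding path_in_def by auto
    show "successively adj (A @ M @ [y])"
      using A(1) M(1) h(4,5) P(2,4) unfolding path_in_def by (simp add: successively_append_iff)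
  qed auto
  then have "length (A @ M @ [y]) \<le> length P" by (rule P_longest)
  then show False using last_segment_short[OF h12] P(6) M(2) by simp
qed

end

section \<open>Existence of a Hamilton path\<close>

lemma (in simple_graph) component_through:
  assumes "h0 \<in> V - X"
  obtains H where "h0 \<in> H" "H \<subseteq> V - X"
    "\<And>h h'. \<lbrakk>h \<in> H; h' \<in> H\<rbrakk> \<Longrightarrow> \<exists>M. path_in H h M h'"
    "\<And>h v. \<lbrakk>h \<in> H; adj h v\<rbrakk> \<Longrightarrow> v \<in> H \<union> X"
proof
  let ?R = "{(u, v). adj u v \<and> u \<notin> X \<and> v \<notin> X}"
  let ?H = "?R\<^sup>* `` {h0}"
  show "h0 \<in> ?H" by simp
  show sub: "?H \<subseteq> V - X"
  proof
    fix h assume "h \<in> ?H"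
    then have "(h0, h) \<in> ?R\<^sup>*" by simp
    then show "h \<in> V - X" using assms adj_V2 by (induction rule: rtrancl_induct) auto
  qed
  have sym: "sym (?R\<^sup>*)" by (rule sym_rtrancl) (auto simp: sym_def adj_commute)
  show "\<exists>M. path_in ?H h M h'" if "h \<in> ?H" "h' \<in> ?H" for h h'
  proof -
    have "(h, h0) \<in> ?R\<^sup>*" using that(1) symD[OF sym] by blast
    then have "(h, h') \<in> ?R\<^sup>*" using that(2) by (auto intro: rtrancl_trans)
    then obtain M where "path_in (?R\<^sup>* `` {h}) h M h'"
      using path_in_if_reachable[of h h' ?R] by blast
    moreover have "?R\<^sup>* `` {h} \<subseteq> ?H" using that(1) by (auto intro: rtrancl_trans)
    ultimately show ?thesis using path_in_mono by blast
  qed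
  show "v \<in> ?H \<union> X" if "h \<in> ?H" "adj h v" for h v
  proof (cases "v \<in> X")
    case False
    have "h \<notin> X" using that(1) sub by blast
    then have "(h, v) \<in> ?R" using that(2) False by simp
    then show ?thesis using that(1) by (auto intro: rtrancl_into_rtrancl)
  qed simp
qed

lemma (in K2_kK1_free) hamilton_path_exists:
  assumes k_pos: "0 < k"
    and degree: "\<And>v. v \<in> V \<Longrightarrow> 2 * k \<le> card {w. adj v w}"
    and alpha: "\<And>I. indep I \<Longrightarrow> 2 * card I < card V"
    and large: "indep I" "2 * k < card I"
    and separation: "\<And>S A B. separates S A B \<Longrightarrow> k \<le> card S"
    and xy: "x \<in> V" "y \<in> V" "x \<noteq> y"
  shows "\<exists>P. path_in V x P y \<and> set P = V"
proof -
  have "\<exists>p. path_in V x p y"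
  proof (rule ccontr)
    assume none: "\<not> ?thesis"
    obtain H where H: "x \<in> H" "H \<subseteq> V - {}"
      "\<And>h h'. \<lbrakk>h \<in> H; h' \<in> H\<rbrakk> \<Longrightarrow> \<exists>M. path_in H h M h'"
      "\<And>h v. \<lbrakk>h \<in> H; adj h v\<rbrakk> \<Longrightarrow> v \<in> H \<union> {}"
      using component_through[of x "{}"] xy(1) by (metis Diff_empty)
    have "y \<notin> H"
    proof
      assume "y \<in> H"
      then obtain p where "path_in H x p y" using H(1,3) by blast
      then show False using none path_in_mono[of H x p y V] H(2) by blast
    qed
    then have "k \<le> card ({} :: 'a set)"
      using H xy(2) by (intro separation[of "{}" H "V - H"]) (auto simp: separates_def)
    then show False using k_pos by simp
  qed
  then obtain p where "path_in V x p y" by blast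
  moreover have "\<forall>p. path_in V x p y \<longrightarrow> length p < Suc (card V)"
    using finite_V card_mono distinct_card unfolding path_in_def by (metis le_imp_less_Suc)
  ultimately obtain P where P: "path_in V x P y"
    and P_max: "\<forall>Q. path_in V x Q y \<longrightarrow> length Q \<le> length P"
    using ex_has_greatest_nat[of "\<lambda>p. path_in V x p y" p length "Suc (card V)"] by blast
  have "set P = V"
  proof (rule ccontr)
    assume "set P \<noteq> V"
    then obtain h0 where "h0 \<in> V - set P" using P unfolding path_in_def by blast
    then obtain H where H: "h0 \<in> H" "H \<subseteq> V - set P"
      "\<And>h h'. \<lbrakk>h \<in> H; h' \<in> H\<rbrakk> \<Longrightarrow> \<exists>M. path_in H h M h'"
      "\<And>h v. \<lbrakk>h \<in> H; adj h v\<rbrakk> \<Longrightarrow> v \<in> H \<union> set P"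
      using component_through[of h0 "set P"] by metis
    interpret missed_component_in_free V adj x y P H k
      by unfold_locales (use P P_max H xy(3) in auto)
    show False
    proof (cases "\<exists>e\<in>H. \<exists>e'\<in>H. adj e e'")
      case True
      then obtain e e' where e: "e \<in> H" "e' \<in> H" "adj e e'" by blast
      interpret missed_component_with_edge V adj x y P H k e e'
        by unfold_locales (use e separation in auto)
      show False using independent_sets_small[OF degree large(1)] large(2) by simp
    next
      case False
      have "h = h0" if h: "h \<in> H" for h
      proof (rule ccontr)
        assume "h \<noteq> h0"
        obtain M where M: "path_in H h0 M h" using H(3)[OF H(1) h] by blast
        then obtain z M' where "M = h0 # z # M'"
          using \<open>h \<noteq> h0\<close> unfolding path_in_def by (cases M rule: remdups_adj.cases) auto
        then have "adj h0 z" "z \<in> H" using M unfolding path_in_def by auto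
        then show False using False H(1) by blast
      qed
      then have "H = {h0}" using H(1) by blast
      then show False
        using component_not_singleton degree alpha H(1,2) by blast
    qed
  qed
  then show ?thesis using P by blast
qed

section \<open>Translation to the graph library\<close>

lemma vpath_if_successively:
  assumes "p \<noteq> []" "distinct p" "set p \<subseteq> pverts G" "successively (\<lambda>u v. (u, v) \<in> parcs G) p"
  shows "vpath p (with_proj G)"
proof -
  have "set (vwalk_arcs p) \<subseteq> parcs G"
    using assms(4) by (induction p rule: vwalk_arcs.induct) auto
  then show ?thesis using assms(1-3) by (simp add: vpath_def vwalk_def)
qed

lemma simple_graph_of_pair_graph:
  assumes "pair_graph G"
  shows "simple_graph (pverts G) (\<lambda>u v. (u, v) \<in> parcs G)"
proof -
  interpret pair_graph G by fact
  show ?thesis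
    using pair_finite_verts in_arcsD1 pair_no_loops[of "(v, v)" for v] pair_sym_arcs
    by unfold_locales (auto simp: symmetric_def sym_def)
qed

text \<open>
  Library connectivity passes through the symmetric closure of the arcs, which is why the arc that is
  found may have either direction.
\<close>

lemma connected_not_separated:
  assumes "connected (with_proj G \<restriction> (A \<union> B))" "A \<noteq> {}" "B \<noteq> {}" "A \<inter> B = {}"
  obtains a b where "a \<in> A" "b \<in> B" "(a, b) \<in> parcs G \<or> (b, a) \<in> parcs G"
proof (rule ccontr)
  assume none: "\<not> thesis"
  let ?M = "with_proj (mk_symmetric (with_proj G \<restriction> (A \<union> B)))"
  obtain a b where ab: "a \<in> A" "b \<in> B" using assms(2,3) by blast
  then have "a \<rightarrow>\<^sup>*\<^bsub>?M\<^esub> b"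
    using assms(1) by (simp add: connected_def strongly_connected_def mk_symmetric_def)
  then have "(a, b) \<in> (parcs (mk_symmetric (with_proj G \<restriction> (A \<union> B))))\<^sup>*"
    using reachable_rtranclI by fastforce
  then have "b \<in> A"
  proof (induction rule: rtrancl_induct)
    case base
    show ?case by (rule ab(1))
  next
    case (step u v)
    then have "u \<in> A" "v \<in> A \<union> B" "(u, v) \<in> parcs G \<or> (v, u) \<in> parcs G"
      by (auto simp: mk_symmetric_def)
    then show ?case using that none by blast
  qed
  then show False using ab(2) assms(4) by blast
qed

lemma k_le_card_separator:
  assumes "pair_graph G" "k_connected k G"
    and sep: "simple_graph.separates (pverts G) (\<lambda>u v. (u, v) \<in> parcs G) S A B"
  shows "k \<le> card S"
proof (rule ccontr)
  interpret simple_graph "pverts G" "\<lambda>u v. (u, v) \<in> parcs G"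
    by (rule simple_graph_of_pair_graph[OF assms(1)])
  assume "\<not> k \<le> card S"
  moreover have S: "S \<subset> pverts G" "pverts G - S = A \<union> B" "A \<noteq> {}" "B \<noteq> {}" "A \<inter> B = {}"
    using sep unfolding separates_def by blast+
  ultimately have "connected (with_proj G \<restriction> (A \<union> B))"
    using assms(2) unfolding k_connected_def by (metis not_le)
  then obtain a b where "a \<in> A" "b \<in> B" "(a, b) \<in> parcs G \<or> (b, a) \<in> parcs G"
    using S(3-5) by (rule connected_not_separated)
  then show False using sep adj_sym unfolding separates_def by blast
qed

text \<open>
  Otherwise the edge and \<open>k\<close> members of \<open>I\<close> induce the forbidden graph. The isomorphism sends its edge
  \<open>{0, 1}\<close> to \<open>{u, v}\<close> and enumerates these members by the other numbers.
\<close>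

lemma card_nonadjacent_independent_less:
  assumes "pair_graph G" and free: "induced_free (K2_union_kK1 k) G"
    and uv: "(u, v) \<in> parcs G"
    and I: "independent_set G I" "\<And>w. w \<in> I \<Longrightarrow> (u, w) \<notin> parcs G \<and> (v, w) \<notin> parcs G"
  shows "card I < k"
proof (rule ccontr)
  interpret simple_graph "pverts G" "\<lambda>u v. (u, v) \<in> parcs G"
    by (rule simple_graph_of_pair_graph[OF assms(1)])
  interpret pair_graph G by fact
  assume "\<not> card I < k"
  then obtain J where J: "J \<subseteq> I" "card J = k"
    by (metis not_less obtain_subset_with_card_n)
  have V: "u \<in> pverts G" "v \<in> pverts G" "J \<subseteq> pverts G"
    using uv adj_V adj_V2 J(1) I(1) by (auto simp: independent_set_def)
  have ne: "u \<noteq> v" "u \<notin> J" "v \<notin> J"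
    using uv adj_irrefl adj_sym I(2) J(1) by blast+
  have "finite J" using V(3) finite_V finite_subset by blast
  then obtain g where "bij_betw g {0..<k} J" using ex_bij_betw_nat_finite J(2) by metis
  then have g: "inj_on g {..<k}" "g ` {..<k} = J"
    by (auto simp: bij_betw_def atLeast0LessThan)
  define f where "f i = (if i = 0 then u else if i = 1 then v else g (i - 2))" for i :: nat
  have f01: "f 0 = u" "f 1 = v" and f2: "f (i + 2) = g i" for i
    by (simp_all add: f_def)
  have split: "{..<k + 2} = {0, 1} \<union> (\<lambda>i. i + 2) ` {..<k}"
  proof (rule set_eqI)
    fix i show "i \<in> {..<k + 2} \<longleftrightarrow> i \<in> {0, 1} \<union> (\<lambda>i. i + 2) ` {..<k}"
      by (cases "i < 2") (auto simp: image_iff intro!: bexI[of _ "i - 2"])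
  qed
  have image_f: "f ` {..<k + 2} = {u, v} \<union> J"
    unfolding split image_Un image_image f2 g(2) using f01 by simp
  have "card ({u, v} \<union> J) = k + 2"
    using ne J(2) \<open>finite J\<close> by simp
  then have inj_f: "inj_on f {..<k + 2}"
    using image_f by (intro eq_card_imp_inj_on) auto
  define H where "H = \<lparr> pverts = {u, v} \<union> J, parcs = {(u, v), (v, u)} \<rparr>"
  have "wf_digraph (with_proj H)" by unfold_locales (auto simp: H_def)
  moreover have "{e \<in> parcs G. fst e \<in> {u, v} \<union> J \<and> snd e \<in> {u, v} \<union> J} = {(u, v), (v, u)}"
  proof (rule set_eqI)
    fix e :: "'a \<times> 'a"
    obtain a b where e: "e = (a, b)" by (cases e)
    have "\<not> (a \<in> J \<and> (b \<in> J \<or> b = u \<or> b = v) \<or> (a = u \<or> a = v) \<and> b \<in> J)" if "(a, b) \<in> parcs G"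
      using that adj_sym[OF that] I J(1) unfolding independent_set_def by blast
    then show "e \<in> {e \<in> parcs G. fst e \<in> {u, v} \<union> J \<and> snd e \<in> {u, v} \<union> J} \<longleftrightarrow> e \<in> {(u, v), (v, u)}"
      using uv adj_sym[OF uv] adj_irrefl[of u] adj_irrefl[of v] unfolding e by auto
  qed
  ultimately have induced: "induced_subgraph (with_proj H) (with_proj G)"
    using V uv adj_sym wf_digraph_axioms
    by (auto simp: induced_subgraph_def subgraph_def compatible_def H_def)
  let ?hom = "\<lparr> iso_verts = f, iso_arcs = map_prod f f, iso_head = snd, iso_tail = fst \<rparr>"
  have "wf_digraph (with_proj (K2_union_kK1 k))"
    by unfold_locales (auto simp: K2_union_kK1_def)
  then have "pre_digraph.digraph_isomorphism (with_proj (K2_union_kK1 k)) ?hom"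
    using inj_f ne(1) f01
    by (auto simp: pre_digraph.digraph_isomorphism_def K2_union_kK1_def inj_on_def)
  moreover have "with_proj H = app_iso ?hom (with_proj (K2_union_kK1 k))"
    using image_f f01 by (simp add: app_iso_def with_proj_def H_def K2_union_kK1_def)
  ultimately have "digraph_iso (with_proj (K2_union_kK1 k)) (with_proj H)"
    unfolding digraph_iso_def by blast
  then show False using free induced unfolding induced_free_def by blast
qed

lemma min_degree_le_card_neighbours:
  assumes "pair_graph G" "v \<in> pverts G"
  shows "min_degree G \<le> card {w. (v, w) \<in> parcs G}"
proof -
  interpret pair_graph G by fact
  have "out_arcs (with_proj G) v = Pair v ` {w. (v, w) \<in> parcs G}"
    by (auto simp: out_arcs_def)
  then have "out_degree (with_proj G) v = card {w. (v, w) \<in> parcs G}"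
    unfolding out_degree_def by (simp add: card_image inj_on_def)
  moreover have "min_degree G \<le> out_degree (with_proj G) v"
    unfolding min_degree_def using assms(2) pair_finite_verts by (intro Min_le) auto
  ultimately show ?thesis by simp
qed

lemma
  assumes "finite (pverts G)"
  shows card_le_independence_number: "independent_set G I \<Longrightarrow> card I \<le> independence_number G"
    and independence_number_attained: "\<exists>I. independent_set G I \<and> card I = independence_number G"
proof -
  have fin: "finite (card ` {S. independent_set G S})"
    using assms by (auto simp: independent_set_def intro!: finite_imageI finite_subset[of _ "Pow (pverts G)"])
  then show "independent_set G I \<Longrightarrow> card I \<le> independence_number G"
    unfolding independence_number_def by (intro Max_ge) auto
  have "independent_set G {}" by (simp add: independent_set_def)
  then have "Max (card ` {S. independent_set G S}) \<in> card ` {S. independent_set G S}"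
    using fin by (intro Max_in) auto
  then show "\<exists>I. independent_set G I \<and> card I = independence_number G"
    unfolding independence_number_def by auto
qed

theorem theorem1p11:
  fixes k n :: nat and G :: "'a pair_pre_digraph"
  assumes "k \<ge> 1"
    and "pair_graph G"
    and "card (pverts G) = n"
    and "k_connected k G"
    and "induced_free (K2_union_kK1 k) G"
    and "2 * k + 1 \<le> independence_number G"
    and "real (independence_number G) < real n / 2"
    and "min_degree G \<ge> 2 * k"
  shows "hamilton_connected G"
proof -
  let ?V = "pverts G" and ?adj = "\<lambda>u v. (u, v) \<in> parcs G"
  interpret simple_graph ?V ?adj by (rule simple_graph_of_pair_graph[OF assms(2)])
  have indep: "indep I \<longleftrightarrow> independent_set G I" for I
    by (simp add: indep_def independent_set_def)
  interpret K2_kK1_free ?V ?adj k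
    using card_nonadjacent_independent_less[OF assms(2,5)] indep by unfold_locales blast
  have degree: "2 * k \<le> card {w. ?adj v w}" if "v \<in> ?V" for v
    using min_degree_le_card_neighbours[OF assms(2) that] assms(8) by simp
  have "2 * independence_number G < card ?V" using assms(3,7) by simp
  then have small: "2 * card I < card ?V" if "indep I" for I
    using card_le_independence_number[OF finite_V] that indep by fastforce
  obtain I where I: "indep I" "2 * k < card I"
    using independence_number_attained[OF finite_V] assms(6) indep by force
  have "\<exists>P. hamilton_path G x P y" if xy: "x \<in> ?V" "y \<in> ?V" "x \<noteq> y" for x y
  proof -
    have "\<exists>P. path_in ?V x P y \<and> set P = ?V"
    proof (rule hamilton_path_exists)
      show "0 < k" using assms(1) by simp
      show "k \<le> card S" if "separates S A B" for S A B
        using that by (rule k_le_card_separator[OF assms(2,4)])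
    qed (use degree small I xy in auto)
    then obtain P where "path_in ?V x P y" "set P = ?V" by blast
    then have "hamilton_path G x P y"
      unfolding hamilton_path_def path_in_def using vpath_if_successively[of P G] by simp
    then show ?thesis by blast
  qed
  then show ?thesis unfolding hamilton_connected_def by blast
qed

end
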